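(* Let $A\in\mathbb{C}^{n\times n}$ of rank $r>0$ be written in the Hartwig–Spindelböck decomposition $A=U\begin{bmatrix}\Sigma K&\Sigma L\\0&0\end{bmatrix}U^*$ (as in the context), and let $m\in\mathbb{N}=\{1,2,\dots\}$. Then $$A^{\#_m}=U\begin{bmatrix}(\Sigma K)^{\mathrm{WG}_m}P_{(\Sigma K)^{m-1}}&0\\0&0\end{bmatrix}U^*.$$
   Context: Hartwig–Spindelböck decomposition: any $A\in\mathbb{C}^{n\times n}$ of rank $r>0$ can be written as $A=U\begin{bmatrix}\Sigma K&\Sigma L\\0&0\end{bmatrix}U^*$ with $U$ unitary, $\Sigma=\mathrm{diag}(\sigma_1I_{r_1},\dots,\sigma_sI_{r_s})$, $\sigma_1>\dots>\sigma_s>0$ the singular values of $A$, $r_1+\dots+r_s=r$, and $K\in\mathbb{C}^{r\times r}$, $L\in\mathbb{C}^{r\times(n-r)}$ with $KK^*+LL^*=I_r$. For a square matrix $B$: $B^\dagger$ Moore–Penrose inverse, $P_B=BB^\dagger$, $B^0=I$, $\mathcal{R}(\cdot)$ column space; $\mathrm{Ind}(B)$ is the smallest nonnegative integer $k$ with $\mathcal{R}(B^k)=\mathcal{R}(B^{k+1})$. The core-EP inverse $B^{\mathrm{cEP}}$ is the unique $X$ with $XBX=X$ and $\mathcal{R}(X)=\mathcal{R}(X^* )=\mathcal{R}(B^k)$, $k=\mathrm{Ind}(B)$. For $m\in\mathbb{N}$, the $m$-weak group inverse is $B^{\mathrm{WG}_m}:=(B^{\mathrm{cEP}})^{m+1}B^m$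 and the $m$-weak core inverse is $B^{\#_m}:=B^{\mathrm{WG}_m}P_{B^m}$. *)

theory Defs
  imports "Jordan_Normal_Form.Schur_Decomposition" "Jordan_Normal_Form.DL_Rank"
begin

definition cspace :: "complex mat \<Rightarrow> complex vec set" where
  "cspace B = {B *\<^sub>v x | x. x \<in> carrier_vec (dim_col B)}"

definition is_MP_inverse :: "complex mat \<Rightarrow> complex mat \<Rightarrow> bool" where
  "is_MP_inverse B X \<longleftrightarrow> X \<in> carrier_mat (dim_col B) (dim_row B) \<and>
     B * X * B = B \<and> X * B * X = X \<and>
     mat_adjoint (B * X) = B * X \<and> mat_adjoint (X * B) = X * B"

definition mp_inverse :: "complex mat \<Rightarrow> complex mat" where
  "mp_inverse B = (THE X. is_MP_inverse B X)"

definition proj_mat :: "complex mat \<Rightarrow> complex mat" where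
  "proj_mat B = B * mp_inverse B"

definition mat_index :: "complex mat \<Rightarrow> nat" where
  "mat_index B = (LEAST k. cspace (B ^\<^sub>m k) = cspace (B ^\<^sub>m (Suc k)))"

definition core_EP :: "complex mat \<Rightarrow> complex mat" where
  "core_EP B = (THE X. X \<in> carrier_mat (dim_row B) (dim_row B) \<and> X * B * X = X \<and>
      cspace X = cspace (B ^\<^sub>m mat_index B) \<and>
      cspace (mat_adjoint X) = cspace (B ^\<^sub>m mat_index B))"

definition weak_group :: "nat \<Rightarrow> complex mat \<Rightarrow> complex mat" where
  "weak_group m B = (core_EP B) ^\<^sub>m (Suc m) * B ^\<^sub>m m"

definition weak_core :: "nat \<Rightarrow> complex mat \<Rightarrow> complex mat" where
  "weak_core m B = weak_group m B * proj_mat (B ^\<^sub>m m)"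

end

theory Submission
  imports Defs
begin

text \<open>Let \<open>V\<close> consist of the first \<open>r\<close> columns of \<open>U\<close> and let \<open>G = [\<Sigma>K \<Sigma>L] U\<^sup>*\<close>, so that \<open>A = V G\<close> and
  \<open>G V = \<Sigma>K\<close>. Here \<open>V\<close> is an isometry, and \<open>G\<close> is right invertible because \<open>K K\<^sup>* + L L\<^sup>* = I\<close> and \<open>\<Sigma>\<close>
  is invertible. For such a factorization \<open>A\<^sup>k\<^sup>+\<^sup>1 = V (G V)\<^sup>k G\<close>, and hence the range of \<open>A\<^sup>k\<^sup>+\<^sup>1\<close> is the
  image under \<open>V\<close> of the range of \<open>(G V)\<^sup>k\<close>. It follows that conjugation by \<open>V\<close> carries the core-EP
  inverse of \<open>G V\<close> to that of \<open>A\<close>, and the projector onto the range of \<open>(G V)\<^sup>k\<close> to the one for \<open>A\<^sup>k\<^sup>+\<^sup>1\<close>;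
  in the product defining the weak core inverse the inner factors \<open>V\<^sup>* V\<close> cancel.\<close>

section \<open>Adjoints, cancellation and powers\<close>

lemma mat_mult_assoc:
  fixes A B C :: "'a :: semiring_0 mat"
  assumes "dim_col A = dim_row B" "dim_col B = dim_row C"
  shows "A * B * C = A * (B * C)"
  using assms by (intro assoc_mult_mat) auto

lemma mat_adjoint_dim [simp]:
  "dim_row (mat_adjoint A) = dim_col A" "dim_col (mat_adjoint A) = dim_row A"
  by (auto simp: mat_adjoint_def)

lemma mat_adjoint_carrier [simp]:
  "A \<in> carrier_mat n k \<Longrightarrow> mat_adjoint A \<in> carrier_mat k n"
  by (auto intro: carrier_matI)

lemma index_mat_adjoint [simp]:
  "i < dim_col A \<Longrightarrow> j < dim_row A \<Longrightarrow> mat_adjoint A $$ (i, j) = conjugate (A $$ (j, i))"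
  by (auto simp: mat_adjoint_def mat_of_rows_def)

lemma mat_adjoint_adjoint [simp]: "mat_adjoint (mat_adjoint A) = A"
  by (rule eq_matI) auto

lemma mat_adjoint_one [simp]: "mat_adjoint (1\<^sub>m n) = (1\<^sub>m n :: complex mat)"
  by (rule eq_matI) auto

lemma mat_adjoint_mult:
  fixes A B :: "complex mat"
  assumes "dim_col A = dim_row B"
  shows "mat_adjoint (A * B) = mat_adjoint B * mat_adjoint A"
  using assms by (intro eq_matI) (auto simp: scalar_prod_def mult.commute)

text \<open>The diagonal entry of \<open>mat_adjoint Z * Z\<close> at \<open>(j, j)\<close> is the
  squared Euclidean norm of column \<open>j\<close> of \<open>Z\<close>.\<close>

lemma mat_adjoint_mult_eq_0:
  fixes Z :: "complex mat"
  assumes "mat_adjoint Z * Z = 0\<^sub>m (dim_col Z) (dim_col Z)"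
  shows "Z = 0\<^sub>m (dim_row Z) (dim_col Z)"
proof (rule eq_matI, simp_all)
  fix i j assume ij: "i < dim_row Z" "j < dim_col Z"
  have "(mat_adjoint Z * Z) $$ (j, j) = 0"
    using assms ij by simp
  moreover have "(mat_adjoint Z * Z) $$ (j, j) = (\<Sum>i<dim_row Z. (cmod (Z $$ (i, j)))\<^sup>2)"
    using ij by (simp add: scalar_prod_def atLeast0LessThan complex_norm_square mult.commute
        del: of_real_power)
  ultimately have "(\<Sum>i<dim_row Z. (cmod (Z $$ (i, j)))\<^sup>2) = 0"
    by (metis of_real_eq_0_iff)
  then have "\<forall>i\<in>{..<dim_row Z}. (cmod (Z $$ (i, j)))\<^sup>2 = 0"
    by (subst (asm) sum_nonneg_eq_0_iff) auto
  then show "Z $$ (i, j) = 0"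
    using ij by simp
qed

text \<open>Multiplying the hypothesis by \<open>mat_adjoint Y\<close> on the left makes the Gram
  matrix of \<open>B * Y\<close> vanish.\<close>

lemma mat_adjoint_mult_cancel:
  fixes B Y :: "complex mat"
  assumes B: "B \<in> carrier_mat n p" and Y: "Y \<in> carrier_mat p q"
    and 0: "mat_adjoint B * (B * Y) = 0\<^sub>m p q"
  shows "B * Y = 0\<^sub>m n q"
proof -
  have "mat_adjoint (B * Y) * (B * Y) = mat_adjoint Y * (mat_adjoint B * (B * Y))"
    using B Y by (simp add: mat_adjoint_mult mat_mult_assoc)
  also have "\<dots> = 0\<^sub>m q q"
    unfolding 0 using Y by (intro right_mult_zero_mat) auto
  finally show ?thesis
    using mat_adjoint_mult_eq_0[of "B * Y"] B Y by simp
qed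

lemma pow_mat_Suc_left:
  fixes B :: "'a :: semiring_1 mat"
  assumes "B \<in> carrier_mat n n"
  shows "B ^\<^sub>m (Suc p) = B * B ^\<^sub>m p"
  using assms by (induction p) (auto simp: mat_mult_assoc)

lemma mat_adjoint_pow:
  fixes B :: "complex mat"
  assumes B: "B \<in> carrier_mat n n"
  shows "mat_adjoint (B ^\<^sub>m p) = mat_adjoint B ^\<^sub>m p"
proof (induction p)
  case 0
  show ?case using B by simp
next
  case (Suc p)
  have "mat_adjoint (B ^\<^sub>m Suc p) = mat_adjoint B * mat_adjoint B ^\<^sub>m p"
    using B by (simp add: mat_adjoint_mult Suc)
  then show ?case
    using pow_mat_Suc_left[of "mat_adjoint B" n p] B by simp
qed

section \<open>Column spaces and the index of a matrix\<close>

lemma cspace_image: "cspace B = (\<lambda>x. B *\<^sub>v x) ` carrier_vec (dim_col B)"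
  unfolding cspace_def by (rule Setcompr_eq_image)

lemma cspace_mult:
  assumes "dim_col B = dim_row C"
  shows "cspace (B * C) = (\<lambda>x. B *\<^sub>v x) ` cspace C"
  unfolding cspace_image image_image index_mult_mat
  using assms by (intro image_cong refl assoc_mult_mat_vec) auto

lemma cspace_mult_subset:
  assumes "dim_col B = dim_row C"
  shows "cspace (B * C) \<subseteq> cspace B"
  unfolding cspace_mult[OF assms] unfolding cspace_image
  using assms by (intro image_mono) (auto intro: carrier_vecI)

text \<open>Each column of \<open>B\<close> is the image of a unit vector, hence has a preimage
  under \<open>C\<close>; these preimages are the columns of \<open>Z\<close>. This turns inclusions
  of ranges into matrix identities.\<close>

lemma cspace_subsetD:
  assumes B: "B \<in> carrier_mat n p" and C: "C \<in> carrier_mat n q"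
    and sub: "cspace B \<subseteq> cspace C"
  obtains Z where "Z \<in> carrier_mat q p" "B = C * Z"
proof -
  have "\<exists>x. x \<in> carrier_vec q \<and> col B j = C *\<^sub>v x" if "j < p" for j
  proof -
    have "col B j = B *\<^sub>v unit_vec p j"
      using B that by (intro eq_vecI) auto
    then have "col B j \<in> cspace B"
      unfolding cspace_image using B by (intro image_eqI[of _ _ "unit_vec p j"]) auto
    then show ?thesis
      using sub C unfolding cspace_def by auto
  qed
  then obtain f where f: "\<And>j. j < p \<Longrightarrow> f j \<in> carrier_vec q \<and> col B j = C *\<^sub>v f j"
    by metis
  define Z where "Z = mat q p (\<lambda>(i, j). f j $ i)"
  have Z: "Z \<in> carrier_mat q p"
    by (simp add: Z_def)
  have colZ: "col Z j = f j" if "j < p" for j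
    using that f[of j] by (intro eq_vecI) (auto simp: Z_def)
  have "B = C * Z"
  proof (rule mat_col_eqI)
    fix j assume "j < dim_col (C * Z)"
    then have j: "j < p" using Z by simp
    show "col B j = col (C * Z) j"
      using f[OF j] colZ[OF j] col_mult2[OF C Z j] by simp
  qed (use B C Z in auto)
  with Z show ?thesis by (rule that)
qed

text \<open>Each matrix factors through the other, so both inclusions hold. The ranges of core-EP
  inverses are computed this way.\<close>

lemma cspace_eqI:
  assumes "B = C * Z" "C = B * Y" "dim_col C = dim_row Z" "dim_col B = dim_row Y"
  shows "cspace B = cspace C"
  using assms cspace_mult_subset[of C Z] cspace_mult_subset[of B Y] by auto

text \<open>The dimensions of the column spaces of the powers form a non-increasing sequence of
  natural numbers, so its minimum is attained twice in a row.\<close>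

lemma cspace_pow_stabilizes:
  assumes B: "B \<in> carrier_mat n n"
  shows "\<exists>k. cspace (B ^\<^sub>m k) = cspace (B ^\<^sub>m Suc k)"
proof -
  interpret vec_space "TYPE(complex)" n .
  have cs: "col_space C = cspace C" if "C \<in> carrier_mat n n" for C
    unfolding col_space_eq[OF that] cspace_def using that by auto
  obtain k where k: "\<And>j. rank (B ^\<^sub>m k) \<le> rank (B ^\<^sub>m j)"
    using ex_has_least_nat[of "\<lambda>_. True" 0 "\<lambda>j. rank (B ^\<^sub>m j)"] by auto
  let ?W = "cspace (B ^\<^sub>m k)" and ?X = "cspace (B ^\<^sub>m Suc k)"
  have C: "B ^\<^sub>m j \<in> carrier_mat n n" for j
    using B by simp
  have span: "cspace (B ^\<^sub>m j) = span (set (cols (B ^\<^sub>m j)))" for j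
    using cs[OF C] unfolding col_space_def by simp
  have dims: "rank (B ^\<^sub>m j) = vectorspace.dim class_ring (vs (cspace (B ^\<^sub>m j)))" for j
    unfolding rank_def span ..
  have colsub: "set (cols (B ^\<^sub>m j)) \<subseteq> carrier_vec n" for j
    using cols_dim[of "B ^\<^sub>m j"] B by simp
  have sub: "VectorSpace.subspace class_ring (cspace (B ^\<^sub>m j)) V" for j
    unfolding span using colsub by (intro span_is_subspace) simp
  have fin: "vectorspace.fin_dim class_ring (vs (cspace (B ^\<^sub>m j)))" for j
    unfolding span using fin_dim_span_cols[OF C] .
  have XW: "?X \<subseteq> ?W"
    using B by (simp add: cspace_mult_subset)
  have vs: "vectorspace class_ring (vs (cspace (B ^\<^sub>m j)))" for j
    using subspace_is_vs[OF sub] .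
  interpret W: vectorspace class_ring "vs ?W"
    by (rule vs)
  interpret X: vectorspace class_ring "vs ?X"
    by (rule vs)
  have XW': "VectorSpace.subspace class_ring ?X (vs ?W)"
    using nested_subspaces[OF sub sub XW] .
  have vsX: "W.vs Y = vs Y" for Y
    by simp
  \<comment> \<open>The rank is minimal at \<open>k\<close>, so a basis of \<open>?X\<close> has as
    many elements as the dimension of the larger space \<open>?W\<close>. Being independent there as
    well, it is a basis of \<open>?W\<close>, and the two spaces coincide.\<close>
  obtain b where b: "finite b" "X.basis b"
    using X.finite_basis_exists[OF fin] by blast
  have card: "card b = W.dim"
  proof -
    have "card b = X.dim"
      using b X.dim_basis by simp
    moreover have "X.dim \<le> W.dim"
      using W.subspace_dim[OF XW' fin] fin[of "Suc k"] unfolding vsX by blast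
    moreover have "W.dim \<le> X.dim"
      using k[of "Suc k"] unfolding dims .
    ultimately show ?thesis by simp
  qed
  have bX: "b \<subseteq> ?X" and liX: "X.lin_indpt b"
    using b(2) unfolding X.basis_def by auto
  have li: "W.lin_indpt b"
    using liX W.span_li_not_depend(2)[OF bX] XW' unfolding VectorSpace.subspace_def by simp
  have "W.basis b"
    using W.dim_li_is_basis[OF fin b(1) _ li] card bX XW by auto
  then have "W.span b = ?W"
    unfolding W.basis_def by simp
  moreover have "W.span b \<subseteq> ?X"
    using W.span_is_subset[OF bX] XW' unfolding VectorSpace.subspace_def by blast
  ultimately show ?thesis
    using XW by blast
qed

text \<open>The range of each power is the image under \<open>B\<close> of the range of the
  preceding one, so a single equality propagates to all later exponents.\<close>

lemma cspace_pow_mat_index: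
  assumes B: "B \<in> carrier_mat n n" and p: "mat_index B \<le> p"
  shows "cspace (B ^\<^sub>m p) = cspace (B ^\<^sub>m mat_index B)"
  using p
proof (induction p rule: dec_induct)
  case base
  show ?case ..
next
  case (step p)
  have idx: "cspace (B ^\<^sub>m mat_index B) = cspace (B ^\<^sub>m Suc (mat_index B))"
    unfolding mat_index_def by (rule LeastI_ex) (rule cspace_pow_stabilizes[OF B])
  have "cspace (B ^\<^sub>m Suc p) = (\<lambda>x. B *\<^sub>v x) ` cspace (B ^\<^sub>m p)"
    using B by (subst pow_mat_Suc_left[OF B], intro cspace_mult) auto
  also have "\<dots> = (\<lambda>x. B *\<^sub>v x) ` cspace (B ^\<^sub>m mat_index B)"
    using step.IH by simp
  also have "\<dots> = cspace (B ^\<^sub>m Suc (mat_index B))"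
    using B by (subst pow_mat_Suc_left[OF B], intro cspace_mult[symmetric]) auto
  also have "\<dots> = cspace (B ^\<^sub>m mat_index B)"
    using idx ..
  finally show ?case .
qed

text \<open>Stabilization in the form of a matrix identity, to be applied to
  \<open>mat_adjoint B * B\<close> and to \<open>mat_adjoint B\<close>.\<close>

lemma pow_mat_Suc_factor:
  assumes B: "B \<in> carrier_mat n n" and p: "mat_index B \<le> p"
  obtains Z where "Z \<in> carrier_mat n n" "B ^\<^sub>m p = B ^\<^sub>m Suc p * Z"
proof -
  have "cspace (B ^\<^sub>m p) \<subseteq> cspace (B ^\<^sub>m Suc p)"
    using cspace_pow_mat_index[OF B p] cspace_pow_mat_index[OF B, of "Suc p"] p by simp
  from cspace_subsetD[OF pow_carrier_mat[OF B] pow_carrier_mat[OF B] this] that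
  show ?thesis by metis
qed

section \<open>The Moore-Penrose inverse and orthogonal projectors\<close>

text \<open>For hermitian \<open>H\<close>, \<open>H * (H * Y) = 0\<close> has the shape
  \<open>mat_adjoint H * (H * Y) = 0\<close>, so one factor cancels; the induction removes all but
  one.\<close>

lemma hermitian_pow_mult_eq_0:
  fixes H Y :: "complex mat"
  assumes H: "H \<in> carrier_mat n n" "mat_adjoint H = H"
    and "Y \<in> carrier_mat n q" "H ^\<^sub>m k * Y = 0\<^sub>m n q"
  shows "H * Y = 0\<^sub>m n q"
  using assms(3,4)
proof (induction k arbitrary: Y)
  case 0
  then have "Y = 0\<^sub>m n q" using H by simp
  then show ?case using H by simp
next
  case (Suc k)
  have "H ^\<^sub>m k * (H * Y) = 0\<^sub>m n q"
    using Suc.prems H by (simp add: mat_mult_assoc)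
  then have "H * (H * Y) = 0\<^sub>m n q"
    using Suc.IH[of "H * Y"] Suc.prems H by simp
  then show ?case
    using mat_adjoint_mult_cancel[of H n n Y q] H Suc.prems by simp
qed

text \<open>Translates identities \<open>B * Y = B\<close> into vanishing products, the form in
  which the cancellation lemmas apply.\<close>

lemma mat_eq_mult_iff_0:
  fixes B Y :: "complex mat"
  assumes "B \<in> carrier_mat n p" "Y \<in> carrier_mat p p"
  shows "B * (1\<^sub>m p - Y) = 0\<^sub>m n p \<longleftrightarrow> B * Y = B"
proof -
  have *: "B * (1\<^sub>m p - Y) = B - B * Y"
    using assms mult_minus_distrib_mat[of B n p "1\<^sub>m p" p Y] by simp
  have "B - B * Y = 0\<^sub>m n p \<longleftrightarrow> B = B * Y"
  proof
    assume 0: "B - B * Y = 0\<^sub>m n p"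
    show "B = B * Y"
    proof (rule eq_matI)
      fix i j assume "i < dim_row (B * Y)" "j < dim_col (B * Y)"
      then show "B $$ (i, j) = (B * Y) $$ (i, j)"
        using arg_cong[OF 0, of "\<lambda>Z. Z $$ (i, j)"] assms by simp
    qed (use assms in auto)
  next
    assume eq: "B = B * Y"
    show "B - B * Y = 0\<^sub>m n p"
      unfolding eq[symmetric] by (rule minus_r_inv_mat[OF assms(1)])
  qed
  then show ?thesis
    unfolding * by auto
qed

text \<open>With \<open>H = B\<^sup>* B\<close>, stabilization of the column spaces of the powers of \<open>H\<close> and the
  cancellation of hermitian factors give \<open>H = H\<^sup>2 W\<close> for some \<open>W\<close>. Then \<open>G = W\<^sup>* H W\<close> is the group
  inverse of \<open>H\<close>, and \<open>G B\<^sup>*\<close> is the Moore--Penrose inverse of \<open>B\<close>.\<close>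

lemma MP_inverse_exists:
  assumes B: "B \<in> carrier_mat n p"
  shows "\<exists>X. is_MP_inverse B X"
proof -
  define H where "H = mat_adjoint B * B"
  have H: "H \<in> carrier_mat p p" and adjH: "mat_adjoint H = H"
    using B by (auto simp: H_def mat_adjoint_mult)
  obtain W where W: "W \<in> carrier_mat p p" and
    eq: "H ^\<^sub>m mat_index H = H ^\<^sub>m Suc (mat_index H) * W"
    using pow_mat_Suc_factor[OF H order_refl] by blast
  note dims = carrier_matD[OF B] carrier_matD[OF H] carrier_matD[OF W]
  note assoc = mat_mult_assoc
  have HW: "1\<^sub>m p - H * W \<in> carrier_mat p p"
    using H W by (intro minus_carrier_mat) simp
  have "H ^\<^sub>m mat_index H * (H * W) = H ^\<^sub>m mat_index H"
    using eq H W by (simp add: assoc)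
  then have HHW: "H * (H * W) = H"
    using hermitian_pow_mult_eq_0[OF H adjH, of "1\<^sub>m p - H * W" p "mat_index H"] H W HW
      mat_eq_mult_iff_0[of "H ^\<^sub>m mat_index H" p p "H * W"] mat_eq_mult_iff_0[of H p p "H * W"]
    by simp
  \<comment> \<open>Having cancelled the powers of \<open>H\<close> down to one, the remaining
    \<open>mat_adjoint B\<close> in \<open>H\<close> is cancelled too, which gives an identity for
    \<open>B\<close> itself.\<close>
  have "mat_adjoint B * (B * (1\<^sub>m p - H * W)) = H * (1\<^sub>m p - H * W)"
    using B H W by (simp add: H_def assoc)
  then have BHW: "B * (H * W) = B"
    using mat_adjoint_mult_cancel[OF B, of "1\<^sub>m p - H * W" p] B H W HW
      mat_eq_mult_iff_0[of H p p "H * W"] mat_eq_mult_iff_0[of B n p "H * W"] HHW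
    by simp
  \<comment> \<open>\<open>E\<close> turns out to be the orthogonal projector onto the range of
    \<open>H\<close>, and to equal \<open>X * B\<close> for the inverse \<open>X\<close> constructed
    below.\<close>
  define E where "E = H * W"
  have E: "E \<in> carrier_mat p p"
    using H W by (simp add: E_def)
  have WHH: "mat_adjoint W * H * H = H"
    using arg_cong[OF HHW, of mat_adjoint] H W by (simp add: mat_adjoint_mult adjH)
  have WH: "mat_adjoint W * H = E"
  proof -
    have "mat_adjoint W * H = mat_adjoint W * (H * (H * W))"
      by (simp add: HHW)
    also have "\<dots> = mat_adjoint W * H * H * W"
      using dims by (simp add: assoc)
    finally show ?thesis
      unfolding WHH E_def .
  qed
  have adjE: "mat_adjoint E = E"
  proof -
    have "mat_adjoint E = mat_adjoint W * H"
      unfolding E_def using dims by (simp add: mat_adjoint_mult adjH)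
    then show ?thesis by (simp add: WH)
  qed
  define G where "G = E * W"
  have G: "G \<in> carrier_mat p p"
    using E W by (simp add: G_def)
  have G': "G = mat_adjoint W * E"
  proof -
    have "G = mat_adjoint W * H * W"
      by (simp add: G_def WH)
    also have "\<dots> = mat_adjoint W * E"
      unfolding E_def using dims by (simp add: assoc)
    finally show ?thesis .
  qed
  have adjG: "mat_adjoint G = G"
    unfolding G' using W E G by (simp add: mat_adjoint_mult adjE) (simp add: G_def flip: G')
  have EH: "E * H = H"
    using WHH unfolding WH .
  have BE: "B * E = B"
    using BHW unfolding E_def .
  have GH: "G * H = E"
    unfolding G' using dims carrier_matD[OF E] by (simp add: assoc EH WH)
  have EG: "E * G = G"
  proof -
    have "E * E = E * (H * W)"
      by (simp add: E_def)
    also have "\<dots> = E * H * W"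
      using dims carrier_matD[OF E] by (simp add: assoc)
    also have "\<dots> = E"
      unfolding EH by (simp add: E_def)
    finally have "E * E = E" .
    then show ?thesis
      unfolding G_def using dims carrier_matD[OF E] by (simp flip: assoc)
  qed
  note dims = dims carrier_matD[OF E] carrier_matD[OF G]
  define X where "X = G * mat_adjoint B"
  have X: "X \<in> carrier_mat p n"
    using B G by (simp add: X_def)
  have XB: "X * B = E"
    unfolding X_def using dims by (simp add: assoc GH flip: H_def)
  have "is_MP_inverse B X"
    unfolding is_MP_inverse_def
  proof (intro conjI)
    show "X \<in> carrier_mat (dim_col B) (dim_row B)"
      using B X by simp
    show "B * X * B = B"
      using dims X by (subst assoc) (simp_all add: XB BE)
    show "X * B * X = X"
      unfolding XB unfolding X_def using dims by (simp add: EG flip: assoc)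
    show "mat_adjoint (B * X) = B * X"
      unfolding X_def using dims by (simp add: mat_adjoint_mult adjG assoc)
    show "mat_adjoint (X * B) = X * B"
      unfolding XB by (rule adjE)
  qed
  then show ?thesis ..
qed

text \<open>Taking adjoints reverses products of the hermitian matrices \<open>B * X\<close> and
  \<open>B * Y\<close>, which forces them to agree; likewise \<open>X * B = Y * B\<close>. Then
  \<open>X = X * B * X\<close> becomes \<open>Y * B * Y\<close>.\<close>

lemma MP_inverse_unique:
  assumes X: "is_MP_inverse B X" and Y: "is_MP_inverse B Y"
  shows "X = Y"
proof -
  have X1: "B * X * B = B" and X2: "X * B * X = X"
    and X3: "mat_adjoint (B * X) = B * X" and X4: "mat_adjoint (X * B) = X * B"
    and dX [simp]: "dim_row X = dim_col B" "dim_col X = dim_row B"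
    using X unfolding is_MP_inverse_def by auto
  have Y1: "B * Y * B = B" and Y2: "Y * B * Y = Y"
    and Y3: "mat_adjoint (B * Y) = B * Y" and Y4: "mat_adjoint (Y * B) = Y * B"
    and dY [simp]: "dim_row Y = dim_col B" "dim_col Y = dim_row B"
    using Y unfolding is_MP_inverse_def by auto
  have "B * X = mat_adjoint (B * Y * (B * X))"
    by (simp add: X3 Y1 flip: mat_mult_assoc)
  also have "\<dots> = B * X * (B * Y)"
    by (subst mat_adjoint_mult) (simp_all add: X3 Y3)
  also have "\<dots> = B * Y"
    by (simp add: X1 flip: mat_mult_assoc)
  finally have BX: "B * X = B * Y" .
  have "X * B * (Y * B) = X * (B * Y * B)"
    by (simp add: mat_mult_assoc)
  then have "X * B = mat_adjoint (X * B * (Y * B))"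
    by (simp only: Y1 X4)
  also have "\<dots> = Y * B * (X * B)"
    by (subst mat_adjoint_mult) (simp_all add: X4 Y4)
  also have "\<dots> = Y * (B * X * B)"
    by (simp add: mat_mult_assoc)
  also have "\<dots> = Y * B"
    by (simp only: X1)
  finally have XB: "X * B = Y * B" .
  have "X = Y * B * X"
    using X2 unfolding XB ..
  also have "\<dots> = Y * (B * X)"
    by (simp add: mat_mult_assoc)
  also have "\<dots> = Y * B * Y"
    unfolding BX by (simp add: mat_mult_assoc)
  finally show ?thesis
    unfolding Y2 .
qed

lemma is_MP_inverse_mp_inverse: "is_MP_inverse B (mp_inverse B)"
proof -
  obtain X where "is_MP_inverse B X"
    using MP_inverse_exists[of B "dim_row B" "dim_col B"] by auto
  then show ?thesis
    unfolding mp_inverse_def by (rule theI) (erule MP_inverse_unique, fact)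
qed

lemma mp_inverse_dim [simp]:
  "dim_row (mp_inverse B) = dim_col B" "dim_col (mp_inverse B) = dim_row B"
  using is_MP_inverse_mp_inverse[of B] by (auto simp: is_MP_inverse_def)

lemma proj_mat_dim [simp]:
  "dim_row (proj_mat B) = dim_row B" "dim_col (proj_mat B) = dim_row B"
  by (auto simp: proj_mat_def)

lemma proj_mat_mult: "proj_mat B * B = B"
  and mat_adjoint_proj_mat: "mat_adjoint (proj_mat B) = proj_mat B"
  using is_MP_inverse_mp_inverse[of B] by (auto simp: is_MP_inverse_def proj_mat_def)

text \<open>Characterizes the orthogonal projector onto the range of \<open>B\<close>. Since
  \<open>P\<close> fixes \<open>B\<close> and factors through it,
  \<open>P * proj_mat B = proj_mat B\<close> and \<open>proj_mat B * P = P\<close>; taking an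
  adjoint identifies the two.\<close>

lemma proj_mat_eqI:
  assumes P: "mat_adjoint P = P" "P * B = B"
    and Z: "P = B * Z" "dim_row Z = dim_col B" "dim_col Z = dim_row B"
  shows "proj_mat B = P"
proof -
  have [simp]: "dim_row P = dim_row B" "dim_col P = dim_row B"
    using Z by simp_all
  have "proj_mat B = P * proj_mat B"
    using P(2) by (simp add: proj_mat_def flip: mat_mult_assoc)
  also have "\<dots> = mat_adjoint (proj_mat B * P)"
    by (simp add: mat_adjoint_mult P mat_adjoint_proj_mat)
  also have "proj_mat B * P = P"
    unfolding Z(1) using Z(2,3) by (simp add: proj_mat_mult flip: mat_mult_assoc)
  finally show ?thesis
    by (simp add: P)
qed

section \<open>The core-EP inverse: uniqueness and existence\<close>

text \<open>The inclusions give \<open>X = Y * Z\<close> and \<open>Y = mat_adjoint V * X\<close>.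
  The product \<open>Y * B * X\<close> equals \<open>X\<close> by the first and \<open>Y\<close> by
  the second.\<close>

lemma core_EP_unique:
  assumes dims: "X \<in> carrier_mat n n" "Y \<in> carrier_mat n n" "B \<in> carrier_mat n n"
    and X: "X * B * X = X" and Y: "Y * B * Y = Y"
    and sub: "cspace X \<subseteq> cspace Y"
    and sub': "cspace (mat_adjoint Y) \<subseteq> cspace (mat_adjoint X)"
  shows "X = Y"
proof -
  obtain Z where Z: "Z \<in> carrier_mat n n" "X = Y * Z"
    using cspace_subsetD[OF dims(1,2) sub] .
  obtain V where V: "V \<in> carrier_mat n n" "mat_adjoint Y = mat_adjoint X * V"
    using cspace_subsetD[OF _ _ sub', of n n n] dims by auto
  have Y': "Y = mat_adjoint V * X"
    using arg_cong[OF V(2), of mat_adjoint] V(1) dims by (simp add: mat_adjoint_mult)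
  have "Y * B * X = Y * B * Y * Z"
    using Z dims by (simp add: mat_mult_assoc)
  also have "\<dots> = X"
    by (simp only: Y Z(2))
  finally have "Y * B * X = X" .
  moreover have "Y * B * X = mat_adjoint V * (X * B * X)"
    unfolding Y' using V(1) dims by (simp add: mat_mult_assoc)
  ultimately show ?thesis
    unfolding X Y'[symmetric] by simp
qed

text \<open>Any exponent beyond the index may be used, so the index never has to be
  computed.\<close>

lemma core_EP_eqI:
  assumes B: "B \<in> carrier_mat n n" and X: "X \<in> carrier_mat n n" "X * B * X = X"
    and p: "mat_index B \<le> p"
    and range: "cspace X = cspace (B ^\<^sub>m p)" "cspace (mat_adjoint X) = cspace (B ^\<^sub>m p)"
  shows "core_EP B = X"
  unfolding core_EP_def
proof (rule the_equality)
  show *: "X \<in> carrier_mat (dim_row B) (dim_row B) \<and> X * B * X = X \<and>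
      cspace X = cspace (B ^\<^sub>m mat_index B) \<and>
      cspace (mat_adjoint X) = cspace (B ^\<^sub>m mat_index B)"
    using B X range cspace_pow_mat_index[OF B p] by simp
  show "Y = X" if "Y \<in> carrier_mat (dim_row B) (dim_row B) \<and> Y * B * Y = Y \<and>
      cspace Y = cspace (B ^\<^sub>m mat_index B) \<and>
      cspace (mat_adjoint Y) = cspace (B ^\<^sub>m mat_index B)" for Y
    using that * B by (intro core_EP_unique[of Y n X B]) auto
qed

text \<open>The inverse is \<open>B\<^sup>p (B\<^sup>p\<^sup>+\<^sup>1)\<^sup>\<dagger>\<close>, for any \<open>p\<close> beyond the indices of both \<open>B\<close> and \<open>B\<^sup>*\<close>.\<close>

lemma core_EP_exists:
  assumes B: "B \<in> carrier_mat n n"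
  obtains X p where "X \<in> carrier_mat n n" "X * B * X = X" "mat_index B \<le> p"
    "cspace X = cspace (B ^\<^sub>m p)" "cspace (mat_adjoint X) = cspace (B ^\<^sub>m p)"
proof -
  have B': "mat_adjoint B \<in> carrier_mat n n"
    using B by simp
  \<comment> \<open>The index of \<open>B\<close> makes \<open>C\<close> and \<open>D\<close> have
    equal ranges; the index of its adjoint supplies a left factor with
    \<open>C = mat_adjoint Z * D\<close>, from which \<open>X * D = C\<close> follows.\<close>
  define p where "p = max (mat_index B) (mat_index (mat_adjoint B))"
  have p: "mat_index B \<le> p" "mat_index (mat_adjoint B) \<le> p"
    by (auto simp: p_def)
  define C D where "C = B ^\<^sub>m p" and "D = B ^\<^sub>m Suc p"
  have C: "C \<in> carrier_mat n n" and D: "D \<in> carrier_mat n n"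
    unfolding C_def D_def by (rule pow_carrier_mat[OF B])+
  have DBC: "D = B * C"
    unfolding C_def D_def by (rule pow_mat_Suc_left[OF B])
  have CD: "cspace D = cspace C"
    using p cspace_pow_mat_index[OF B, of p] cspace_pow_mat_index[OF B, of "Suc p"]
    unfolding C_def D_def by simp
  define X where "X = C * mp_inverse D"
  note dims = carrier_matD[OF B] carrier_matD[OF C] carrier_matD[OF D]
  have X: "X \<in> carrier_mat n n"
    using dims by (intro carrier_matI) (simp_all add: X_def)
  have MP: "D * mp_inverse D * D = D" "mp_inverse D * D * mp_inverse D = mp_inverse D"
    "mat_adjoint (D * mp_inverse D) = D * mp_inverse D"
    using is_MP_inverse_mp_inverse[of D] by (auto simp: is_MP_inverse_def)
  obtain Z where Z: "Z \<in> carrier_mat n n"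
    "mat_adjoint B ^\<^sub>m p = mat_adjoint B ^\<^sub>m Suc p * Z"
    using pow_mat_Suc_factor[OF B' p(2)] .
  have "mat_adjoint C = mat_adjoint D * Z"
    unfolding C_def D_def mat_adjoint_pow[OF B] by (rule Z(2))
  from arg_cong[OF this, of mat_adjoint] have ZD: "C = mat_adjoint Z * D"
    using Z(1) dims by (simp add: mat_adjoint_mult)
  have XD: "X * D = C"
  proof -
    have "X * D = mat_adjoint Z * (D * mp_inverse D * D)"
      unfolding X_def by (subst ZD) (use Z(1) dims in \<open>simp add: mat_mult_assoc\<close>)
    then show ?thesis
      by (simp only: MP ZD[symmetric])
  qed
  have BX: "B * X = D * mp_inverse D"
    unfolding X_def by (subst DBC) (use dims in \<open>simp add: mat_mult_assoc\<close>)
  have XBX: "X * B * X = X"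
  proof -
    have "X * B * X = C * (mp_inverse D * D * mp_inverse D)"
      using X dims BX by (simp add: mat_mult_assoc) (simp add: X_def dims mat_mult_assoc)
    then show ?thesis
      by (simp only: MP X_def)
  qed
  \<comment> \<open>\<open>B * X\<close> is the orthogonal projector onto the range of
    \<open>D\<close>. Its being hermitian yields factorizations of \<open>D\<close> and
    \<open>mat_adjoint X\<close> through each other.\<close>
  have adj1: "D = mat_adjoint X * (mat_adjoint B * D)"
  proof -
    have "D = mat_adjoint (B * X) * D"
      by (simp add: BX MP)
    then show ?thesis
      using X dims by (simp add: mat_adjoint_mult mat_mult_assoc)
  qed
  have adj2: "mat_adjoint X = D * (mp_inverse D * mat_adjoint X)"
  proof -
    have "mat_adjoint X = mat_adjoint (X * (B * X))"
      using XBX X dims by (simp add: mat_mult_assoc)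
    also have "\<dots> = B * X * mat_adjoint X"
      using X dims by (subst mat_adjoint_mult) (simp_all add: BX MP)
    finally show ?thesis
      unfolding BX using X dims by (simp add: mat_mult_assoc)
  qed
  have "cspace X = cspace C"
    using X_def XD[symmetric] by (rule cspace_eqI) (use X dims in simp_all)
  moreover have "cspace (mat_adjoint X) = cspace D"
    using adj2 adj1 by (rule cspace_eqI) (use X dims in simp_all)
  ultimately show ?thesis
    using that[OF X XBX p(1)] CD unfolding C_def by simp
qed

lemma core_EP_carrier:
  assumes B: "B \<in> carrier_mat n n"
  shows "core_EP B \<in> carrier_mat n n"
proof -
  obtain X p where X: "X \<in> carrier_mat n n" "X * B * X = X" "mat_index B \<le> p"
    "cspace X = cspace (B ^\<^sub>m p)" "cspace (mat_adjoint X) = cspace (B ^\<^sub>m p)"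
    using core_EP_exists[OF B] .
  then show ?thesis
    using core_EP_eqI[OF B X] by simp
qed

section \<open>Passing from \<open>G * V\<close> to \<open>V * G\<close> for an isometry
  \<open>V\<close>\<close>

text \<open>Regrouping leaves one \<open>V\<close> and one \<open>G\<close> outside, so the inner
  exponent drops by one; this is the origin of the exponent \<open>m - 1\<close> in the
  theorem.\<close>

lemma pow_mat_mult_swap:
  fixes V G :: "'a :: semiring_1 mat"
  assumes V: "V \<in> carrier_mat n r" and G: "G \<in> carrier_mat r n"
  shows "(V * G) ^\<^sub>m Suc k = V * (G * V) ^\<^sub>m k * G"
proof (induction k)
  case 0
  show ?case using V G by simp
next
  case (Suc k)
  have "(V * G) ^\<^sub>m Suc (Suc k) = V * (G * V) ^\<^sub>m k * G * (V * G)"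
    using Suc by simp
  also have "\<dots> = V * ((G * V) ^\<^sub>m k * (G * V)) * G"
    using V G by (simp add: mat_mult_assoc)
  finally show ?case by simp
qed

lemma isometry_conj_mult:
  fixes V X Y :: "complex mat"
  assumes V: "V \<in> carrier_mat n r" "mat_adjoint V * V = 1\<^sub>m r"
    and X: "X \<in> carrier_mat r r" and Y: "Y \<in> carrier_mat r q"
  shows "V * X * mat_adjoint V * (V * Y) = V * (X * Y)"
proof -
  have "V * X * mat_adjoint V * (V * Y) = V * (X * (mat_adjoint V * V * Y))"
    using V(1) X Y by (simp add: mat_mult_assoc)
  then show ?thesis
    unfolding V(2) using Y by simp
qed

text \<open>The exponent is a successor because exponent 0 would demand
  \<open>V * mat_adjoint V = 1\<close>, which an isometry need not satisfy.\<close>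

lemma isometry_conj_pow:
  fixes V X :: "complex mat"
  assumes V: "V \<in> carrier_mat n r" "mat_adjoint V * V = 1\<^sub>m r"
    and X: "X \<in> carrier_mat r r"
  shows "(V * X * mat_adjoint V) ^\<^sub>m Suc k = V * X ^\<^sub>m Suc k * mat_adjoint V"
proof (induction k)
  case 0
  show ?case using V(1) X by simp
next
  case (Suc k)
  let ?E = "V * X * mat_adjoint V"
  have E: "?E \<in> carrier_mat n n"
    using V X by (intro carrier_matI) simp_all
  have "?E ^\<^sub>m Suc (Suc k) = ?E * ?E ^\<^sub>m Suc k"
    by (rule pow_mat_Suc_left[OF E])
  also have "\<dots> = ?E * (V * (X ^\<^sub>m Suc k * mat_adjoint V))"
    unfolding Suc using V(1) X by (simp add: mat_mult_assoc)
  also have "\<dots> = V * (X * (X ^\<^sub>m Suc k * mat_adjoint V))"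
    by (rule isometry_conj_mult[OF V X])
      (rule mult_carrier_mat[OF pow_carrier_mat[OF X] mat_adjoint_carrier[OF V(1)]])
  also have "\<dots> = V * (X * X ^\<^sub>m Suc k) * mat_adjoint V"
    using V(1) X by (simp add: mat_mult_assoc)
  finally show ?case
    unfolding pow_mat_Suc_left[OF X, of "Suc k"] .
qed

text \<open>Conjugation by \<open>V\<close> preserves the outer inverse equation, as the inner
  \<open>mat_adjoint V * V\<close> cancels, and sends ranges to their images under \<open>V\<close>.
  The right inverse \<open>R\<close> ensures that a trailing factor \<open>G\<close> does not shrink
  a range.\<close>

lemma core_EP_mult_swap:
  assumes V: "V \<in> carrier_mat n r" "mat_adjoint V * V = 1\<^sub>m r"
    and G: "G \<in> carrier_mat r n" and R: "R \<in> carrier_mat n r" "G * R = 1\<^sub>m r"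
  shows "core_EP (V * G) = V * core_EP (G * V) * mat_adjoint V"
proof -
  have GV: "G * V \<in> carrier_mat r r" and VG: "V * G \<in> carrier_mat n n"
    using G V(1) by auto
  obtain X p where X: "X \<in> carrier_mat r r" "X * (G * V) * X = X" and p: "mat_index (G * V) \<le> p"
    and range: "cspace X = cspace ((G * V) ^\<^sub>m p)" "cspace (mat_adjoint X) = cspace ((G * V) ^\<^sub>m p)"
    using core_EP_exists[OF GV] .
  have core: "core_EP (G * V) = X"
    by (rule core_EP_eqI) (fact GV X p range)+
  \<comment> \<open>Large enough for both matrices: at \<open>q\<close> the ranges for
    \<open>G * V\<close> have stabilized, and \<open>Suc q\<close> is beyond the index of
    \<open>V * G\<close>.\<close>
  define q where "q = max p (mat_index (V * G))"
  have q: "cspace ((G * V) ^\<^sub>m q) = cspace ((G * V) ^\<^sub>m p)"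
    using p cspace_pow_mat_index[OF GV, of p] cspace_pow_mat_index[OF GV, of q]
    by (simp add: q_def)
  have pow: "cspace ((V * G) ^\<^sub>m Suc q) = (\<lambda>x. V *\<^sub>v x) ` cspace ((G * V) ^\<^sub>m p)"
  proof -
    let ?P = "V * (G * V) ^\<^sub>m q"
    have "?P * G * R = ?P * (G * R)"
      using V(1) G R(1) by (simp add: mat_mult_assoc)
    then have "?P = ?P * G * R"
      unfolding R(2) using V(1) G by simp
    from cspace_eqI[OF refl this] have "cspace (?P * G) = cspace ?P"
      using V(1) G R(1) by simp
    then show ?thesis
      unfolding pow_mat_mult_swap[OF V(1) G] using V(1) G by (simp add: cspace_mult q)
  qed
  have rangeV: "cspace (V * Y * mat_adjoint V) = (\<lambda>x. V *\<^sub>v x) ` cspace Y"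
    if Y: "Y \<in> carrier_mat r r" for Y
  proof -
    have "V * Y * mat_adjoint V * V = V * Y * (mat_adjoint V * V)"
      using V(1) Y by (simp add: mat_mult_assoc)
    then have "V * Y = V * Y * mat_adjoint V * V"
      unfolding V(2) using V(1) Y by simp
    from cspace_eqI[OF refl this] have "cspace (V * Y * mat_adjoint V) = cspace (V * Y)"
      using V(1) Y by simp
    then show ?thesis
      using V(1) Y by (simp add: cspace_mult)
  qed
  have "core_EP (V * G) = V * X * mat_adjoint V"
  proof (rule core_EP_eqI[OF VG])
    show "V * X * mat_adjoint V \<in> carrier_mat n n"
      using V(1) X(1) by (intro carrier_matI) simp_all
    have "V * X * mat_adjoint V * (V * G) * (V * X * mat_adjoint V)
        = V * X * mat_adjoint V * (V * (G * V * X * mat_adjoint V))"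
      using V(1) X(1) G by (simp add: mat_mult_assoc)
    also have "\<dots> = V * (X * (G * V * X * mat_adjoint V))"
      by (rule isometry_conj_mult[OF V X(1), of _ n]) (use V(1) X(1) G in \<open>intro carrier_matI; simp\<close>)
    also have "\<dots> = V * (X * (G * V) * X) * mat_adjoint V"
      using V(1) X(1) G by (simp add: mat_mult_assoc)
    finally show "V * X * mat_adjoint V * (V * G) * (V * X * mat_adjoint V) = V * X * mat_adjoint V"
      unfolding X(2) .
    show "mat_index (V * G) \<le> Suc q"
      by (simp add: q_def)
    show "cspace (V * X * mat_adjoint V) = cspace ((V * G) ^\<^sub>m Suc q)"
      unfolding pow rangeV[OF X(1)] range ..
    have "mat_adjoint (V * X * mat_adjoint V) = V * mat_adjoint X * mat_adjoint V"
      using V(1) X(1) by (simp add: mat_adjoint_mult mat_mult_assoc)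
    then show "cspace (mat_adjoint (V * X * mat_adjoint V)) = cspace ((V * G) ^\<^sub>m Suc q)"
      using X(1) by (simp only: pow rangeV mat_adjoint_carrier range)
  qed
  then show ?thesis
    unfolding core .
qed

lemma proj_mat_mult_swap:
  assumes V: "V \<in> carrier_mat n r" "mat_adjoint V * V = 1\<^sub>m r"
    and G: "G \<in> carrier_mat r n" and R: "R \<in> carrier_mat n r" "G * R = 1\<^sub>m r"
  shows "proj_mat ((V * G) ^\<^sub>m Suc k) = V * proj_mat ((G * V) ^\<^sub>m k) * mat_adjoint V"
proof -
  let ?C = "(G * V) ^\<^sub>m k"
  define P Y where "P = proj_mat ?C" and "Y = mp_inverse ?C"
  have GV: "G * V \<in> carrier_mat r r"
    using G V(1) by auto
  have C: "?C \<in> carrier_mat r r"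
    by (rule pow_carrier_mat[OF GV])
  have P: "P \<in> carrier_mat r r" and Y: "Y \<in> carrier_mat r r"
    unfolding P_def Y_def using C by (auto intro!: carrier_matI simp del: pow_mat_dim)
  have P': "mat_adjoint P = P" "P * ?C = ?C" "P = ?C * Y"
    by (simp_all add: P_def Y_def mat_adjoint_proj_mat proj_mat_mult) (simp add: proj_mat_def)
  note dims = carrier_matD[OF V(1)] carrier_matD[OF G] carrier_matD[OF R(1)]
    carrier_matD[OF C] carrier_matD[OF P] carrier_matD[OF Y]
  have "proj_mat (V * ?C * G) = V * P * mat_adjoint V"
  proof (rule proj_mat_eqI)
    show "mat_adjoint (V * P * mat_adjoint V) = V * P * mat_adjoint V"
      using dims by (simp add: mat_adjoint_mult mat_mult_assoc P'(1))
    have "V * P * mat_adjoint V * (V * ?C * G) = V * P * mat_adjoint V * (V * (?C * G))"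
      using dims by (simp add: mat_mult_assoc del: pow_mat_dim)
    also have "\<dots> = V * (P * (?C * G))"
      by (rule isometry_conj_mult[OF V P, of _ n]) (use C G in simp)
    also have "\<dots> = V * (P * ?C) * G"
      using dims by (simp add: mat_mult_assoc del: pow_mat_dim)
    finally show "V * P * mat_adjoint V * (V * ?C * G) = V * ?C * G"
      unfolding P'(2) .
    \<comment> \<open>The factor required by \<open>proj_mat_eqI\<close>: \<open>R\<close> cancels
      \<open>G\<close>, and \<open>?C * Y = P\<close> remains.\<close>
    have "V * ?C * G * (R * Y * mat_adjoint V) = V * (?C * (G * R * Y)) * mat_adjoint V"
      using dims by (simp add: mat_mult_assoc del: pow_mat_dim)
    also have "G * R * Y = Y"
      unfolding R(2) using Y by simp
    finally show "V * P * mat_adjoint V = V * ?C * G * (R * Y * mat_adjoint V)"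
      by (simp only: P'(3)[symmetric])
  qed (use dims in simp_all)
  then show ?thesis
    unfolding pow_mat_mult_swap[OF V(1) G] P_def .
qed

text \<open>After the three factors are rewritten, the \<open>G\<close> ending the power meets the
  \<open>V\<close> opening the projector. Their product raises \<open>C\<close> to the power
  \<open>Suc k\<close> of \<open>?M\<close> that the weak group inverse contains.\<close>

lemma weak_core_mult_swap:
  assumes V: "V \<in> carrier_mat n r" "mat_adjoint V * V = 1\<^sub>m r"
    and G: "G \<in> carrier_mat r n" and R: "R \<in> carrier_mat n r" "G * R = 1\<^sub>m r"
  shows "weak_core (Suc k) (V * G) =
    V * (weak_group (Suc k) (G * V) * proj_mat ((G * V) ^\<^sub>m k)) * mat_adjoint V"
proof -
  let ?M = "G * V"
  define X C P where "X = core_EP ?M ^\<^sub>m Suc (Suc k)" and "C = ?M ^\<^sub>m k"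
    and "P = proj_mat (?M ^\<^sub>m k)"
  have M: "?M \<in> carrier_mat r r"
    using G V(1) by auto
  have core: "core_EP ?M \<in> carrier_mat r r"
    by (rule core_EP_carrier[OF M])
  have X: "X \<in> carrier_mat r r" and C: "C \<in> carrier_mat r r"
    unfolding X_def C_def by (rule pow_carrier_mat[OF core] pow_carrier_mat[OF M])+
  have P: "P \<in> carrier_mat r r"
    using carrier_matD[OF C] unfolding P_def C_def by (intro carrier_matI) (simp_all del: pow_mat_dim)
  note dims = carrier_matD[OF V(1)] carrier_matD[OF G] carrier_matD[OF X] carrier_matD[OF C]
    carrier_matD[OF P]
  have "weak_core (Suc k) (V * G) =
      V * X * mat_adjoint V * (V * C * G) * (V * P * mat_adjoint V)"
    unfolding weak_core_def proj_mat_mult_swap[OF V G R]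
    unfolding weak_group_def core_EP_mult_swap[OF V G R] pow_mat_mult_swap[OF V(1) G]
      isometry_conj_pow[OF V core] X_def C_def P_def ..
  also have "\<dots> = V * X * mat_adjoint V * (V * (C * (G * V) * P * mat_adjoint V))"
    using dims by (simp add: mat_mult_assoc)
  also have "\<dots> = V * (X * (C * (G * V) * P * mat_adjoint V))"
    by (rule isometry_conj_mult[OF V X, of _ n]) (use dims in \<open>intro carrier_matI; simp\<close>)
  also have "\<dots> = V * (X * (C * (G * V)) * P) * mat_adjoint V"
    using dims by (simp add: mat_mult_assoc)
  finally show ?thesis
    unfolding weak_group_def X_def C_def P_def by simp
qed

section \<open>Block form and the Hartwig-Spindelboeck decomposition\<close>

text \<open>\<open>J\<close> embeds the first \<open>r\<close> coordinates, so \<open>U * J\<close>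
  consists of the first \<open>r\<close> columns of \<open>U\<close>. Blocks of zero width or height
  let block multiplication handle the rectangular matrices; the last two claims translate products
  with \<open>U * J\<close> into zero-padded blocks.\<close>

lemma isometry_block:
  fixes U X :: "complex mat"
  assumes U: "U \<in> carrier_mat (r + d) (r + d)" "mat_adjoint U * U = 1\<^sub>m (r + d)"
  defines "J \<equiv> four_block_mat (1\<^sub>m r) (0\<^sub>m r 0) (0\<^sub>m d r) (0\<^sub>m d 0)"
  shows "U * J \<in> carrier_mat (r + d) r" "mat_adjoint (U * J) * (U * J) = 1\<^sub>m r"
    and "X \<in> carrier_mat r r \<Longrightarrow> U * J * X * mat_adjoint (U * J) =
      U * four_block_mat X (0\<^sub>m r d) (0\<^sub>m d r) (0\<^sub>m d d) * mat_adjoint U"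
    and "\<lbrakk>B \<in> carrier_mat r r; C \<in> carrier_mat r d\<rbrakk> \<Longrightarrow>
      U * J * four_block_mat B C (0\<^sub>m 0 r) (0\<^sub>m 0 d) = U * four_block_mat B C (0\<^sub>m d r) (0\<^sub>m d d)"
proof -
  have J: "J \<in> carrier_mat (r + d) r"
    by (intro carrier_matI) (simp_all add: J_def)
  have J': "mat_adjoint J = four_block_mat (1\<^sub>m r) (0\<^sub>m r d) (0\<^sub>m 0 r) (0\<^sub>m 0 d)"
    by (rule eq_matI) (auto simp: J_def)
  note dims = carrier_matD[OF U(1)] carrier_matD[OF J]
  show "U * J \<in> carrier_mat (r + d) r"
    using U(1) J by simp
  have JJ: "mat_adjoint J * J = 1\<^sub>m r"
    unfolding J' unfolding J_def by (subst mult_four_block_mat) (auto intro!: eq_matI)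
  have "mat_adjoint (U * J) * (U * J) = mat_adjoint J * (mat_adjoint U * U * J)"
    using dims by (simp add: mat_adjoint_mult mat_mult_assoc)
  then show "mat_adjoint (U * J) * (U * J) = 1\<^sub>m r"
    unfolding U(2) using J JJ by simp
  show "U * J * four_block_mat B C (0\<^sub>m 0 r) (0\<^sub>m 0 d) = U * four_block_mat B C (0\<^sub>m d r) (0\<^sub>m d d)"
    if B: "B \<in> carrier_mat r r" and C: "C \<in> carrier_mat r d" for B C
  proof -
    have "J * four_block_mat B C (0\<^sub>m 0 r) (0\<^sub>m 0 d) = four_block_mat B C (0\<^sub>m d r) (0\<^sub>m d d)"
      unfolding J_def using B C by (subst mult_four_block_mat) auto
    then show ?thesis
      using dims B C by (simp add: mat_mult_assoc)
  qed
  show "U * J * X * mat_adjoint (U * J) =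
      U * four_block_mat X (0\<^sub>m r d) (0\<^sub>m d r) (0\<^sub>m d d) * mat_adjoint U"
    if X: "X \<in> carrier_mat r r"
  proof -
    have "X = four_block_mat X (0\<^sub>m r 0) (0\<^sub>m 0 r) (0\<^sub>m 0 0)"
      using X by (intro eq_matI) auto
    then have "J * X = J * four_block_mat X (0\<^sub>m r 0) (0\<^sub>m 0 r) (0\<^sub>m 0 0)"
      by (rule arg_cong)
    also have "\<dots> = four_block_mat X (0\<^sub>m r 0) (0\<^sub>m d r) (0\<^sub>m d 0)"
      unfolding J_def using X by (subst mult_four_block_mat) auto
    finally have "J * X = four_block_mat X (0\<^sub>m r 0) (0\<^sub>m d r) (0\<^sub>m d 0)" .
    then have "J * X * mat_adjoint J = four_block_mat X (0\<^sub>m r d) (0\<^sub>m d r) (0\<^sub>m d d)"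
      unfolding J' using X by (simp, subst mult_four_block_mat) (auto)
    moreover have "U * J * X * mat_adjoint (U * J) = U * (J * X * mat_adjoint J) * mat_adjoint U"
      using dims X by (simp add: mat_adjoint_mult mat_mult_assoc)
    ultimately show ?thesis
      by simp
  qed
qed

theorem theorem6p1:
  fixes A U S K L :: "complex mat" and n r m :: nat and \<sigma> :: "nat \<Rightarrow> real"
  assumes A: "A \<in> carrier_mat n n"
    and rank: "vec_space.rank n A = r" and r_pos: "r > 0"
    and U: "U \<in> carrier_mat n n"
    and U_unitary: "U * mat_adjoint U = 1\<^sub>m n" "mat_adjoint U * U = 1\<^sub>m n"
    and S_def: "S = mat_diag r (\<lambda>i. complex_of_real (\<sigma> i))"
    and \<sigma>_pos: "\<forall>i<r. \<sigma> i > 0"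
    and \<sigma>_mono: "\<forall>i j. i \<le> j \<and> j < r \<longrightarrow> \<sigma> j \<le> \<sigma> i"
    and K: "K \<in> carrier_mat r r" and L: "L \<in> carrier_mat r (n - r)"
    and KL: "K * mat_adjoint K + L * mat_adjoint L = 1\<^sub>m r"
    and HS: "A = U * four_block_mat (S * K) (S * L) (0\<^sub>m (n - r) r) (0\<^sub>m (n - r) (n - r))
                 * mat_adjoint U"
    and m: "m \<ge> 1"
  shows "weak_core m A =
    U * four_block_mat (weak_group m (S * K) * proj_mat ((S * K) ^\<^sub>m (m - 1)))
          (0\<^sub>m r (n - r)) (0\<^sub>m (n - r) r) (0\<^sub>m (n - r) (n - r)) * mat_adjoint U"
proof -
  define d where "d = n - r"
  \<comment> \<open>Subtraction on naturals truncates, so the rank bound \<open>r \<le> n\<close>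
    enters here.\<close>
  have n: "n = r + d"
    using vec_space.rank_le_nc[OF A] rank by (simp add: d_def)
  have nr: "n - r = d"
    by (simp add: d_def)
  obtain k where k: "m = Suc k"
    using m by (cases m) auto
  define J :: "complex mat" where "J = four_block_mat (1\<^sub>m r) (0\<^sub>m r 0) (0\<^sub>m d r) (0\<^sub>m d 0)"
  define V where "V = U * J"
  define T where "T = four_block_mat (S * K) (S * L) (0\<^sub>m 0 r) (0\<^sub>m 0 d)"
  define G where "G = T * mat_adjoint U"
  \<comment> \<open>\<open>S'\<close> is the inverse of \<open>S\<close>. In \<open>G * R\<close>
    the unitary factors cancel, leaving
    \<open>S * (K * mat_adjoint K + L * mat_adjoint L) * S'\<close>, which is the identity.\<close>
  define S' where "S' = mat_diag r (\<lambda>i. complex_of_real (1 / \<sigma> i))"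
  define R where "R = U * four_block_mat (mat_adjoint K * S') (0\<^sub>m r 0) (mat_adjoint L * S') (0\<^sub>m d 0)"
  have S: "S \<in> carrier_mat r r" and S': "S' \<in> carrier_mat r r"
    by (simp_all add: S_def S'_def)
  have SS': "S * S' = 1\<^sub>m r"
  proof -
    have "S * S' = mat_diag r (\<lambda>i. complex_of_real (\<sigma> i) * complex_of_real (1 / \<sigma> i))"
      unfolding S_def S'_def by (rule mat_diag_diag)
    also have "\<dots> = 1\<^sub>m r"
      using \<sigma>_pos by (intro eq_matI) (auto simp: mat_diag_def)
    finally show ?thesis .
  qed
  note U' = U[unfolded n] U_unitary(2)[unfolded n]
  note L' = L[unfolded nr]
  have SK: "S * K \<in> carrier_mat r r" and SL: "S * L \<in> carrier_mat r d"
    using S K L' by auto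
  have V: "V \<in> carrier_mat n r" "mat_adjoint V * V = 1\<^sub>m r"
    using isometry_block(1,2)[OF U'] unfolding V_def J_def n .
  have T: "T \<in> carrier_mat r n"
    using S K L' unfolding T_def n by (intro carrier_matI) simp_all
  have G: "G \<in> carrier_mat r n"
    using T U by (simp add: G_def)
  have R: "R \<in> carrier_mat n r"
    unfolding R_def using U K L' S' n by (intro carrier_matI) simp_all
  have GR: "G * R = 1\<^sub>m r"
  proof -
    let ?R = "four_block_mat (mat_adjoint K * S') (0\<^sub>m r 0) (mat_adjoint L * S') (0\<^sub>m d 0)"
    have R': "?R \<in> carrier_mat n r"
      using K L' S' n by (intro carrier_matI) simp_all
    have "G * R = T * (mat_adjoint U * U * ?R)"
      unfolding G_def R_def using carrier_matD[OF U] carrier_matD[OF T] carrier_matD[OF R']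
      by (simp add: mat_mult_assoc)
    also have "\<dots> = T * ?R"
      unfolding U_unitary(2) left_mult_one_mat[OF R'] ..
    also have "\<dots> = four_block_mat (S * K * (mat_adjoint K * S') + S * L * (mat_adjoint L * S'))
        (0\<^sub>m r 0) (0\<^sub>m 0 r) (0\<^sub>m 0 0)"
      unfolding T_def using S K L' S' by (subst mult_four_block_mat) auto
    also have "S * K * (mat_adjoint K * S') + S * L * (mat_adjoint L * S')
        = S * (K * mat_adjoint K + L * mat_adjoint L) * S'"
      using S K L' S' by (simp add: mat_mult_assoc mult_add_distrib_mat[of _ r r _ r]
          add_mult_distrib_mat[of _ r r _ _ r])
    also have "\<dots> = 1\<^sub>m r"
      unfolding KL using S SS' by simp
    also have "four_block_mat (1\<^sub>m r) (0\<^sub>m r 0) (0\<^sub>m 0 r) (0\<^sub>m 0 0) = 1\<^sub>m r"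
      by (rule eq_matI) auto
    finally show ?thesis .
  qed
  have VG: "A = V * G"
  proof -
    have "V * T = U * four_block_mat (S * K) (S * L) (0\<^sub>m d r) (0\<^sub>m d d)"
      unfolding V_def J_def T_def by (rule isometry_block(4)[OF U' SK SL])
    then have "A = V * T * mat_adjoint U"
      unfolding HS nr by simp
    then show ?thesis
      unfolding G_def using carrier_matD[OF U] carrier_matD[OF T] carrier_matD[OF V(1)]
      by (simp add: mat_mult_assoc)
  qed
  have GV: "G * V = S * K"
  proof -
    have J: "J \<in> carrier_mat n r"
      unfolding J_def n by (intro carrier_matI) simp_all
    have "G * V = T * (mat_adjoint U * U * J)"
      unfolding G_def V_def using carrier_matD[OF U] carrier_matD[OF T] carrier_matD[OF J]
      by (simp add: mat_mult_assoc)
    also have "\<dots> = T * J"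
      unfolding U_unitary(2) using J by simp
    also have "\<dots> = four_block_mat (S * K) (0\<^sub>m r 0) (0\<^sub>m 0 r) (0\<^sub>m 0 0)"
      unfolding T_def J_def using S K L' by (subst mult_four_block_mat) auto
    also have "\<dots> = S * K"
      using SK by (intro eq_matI) auto
    finally show ?thesis .
  qed
  let ?X = "weak_group m (S * K) * proj_mat ((S * K) ^\<^sub>m k)"
  have "weak_core m A = V * ?X * mat_adjoint V"
    using weak_core_mult_swap[OF V G R GR, of k] unfolding VG[symmetric] GV k .
  moreover have "?X \<in> carrier_mat r r"
    using S K by (intro carrier_matI) (simp_all add: weak_group_def k
        carrier_matD[OF core_EP_carrier[OF SK]])
  note isometry_block(3)[OF U' this]
  ultimately show ?thesis
    unfolding nr k V_def J_def by simp
qed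

end
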